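(* Let $G_1,G_2$ be topological groups, let $p_1\colon E_1\to B_1$ be a $G_1$-fibration and let $p_2\colon E_2\to B_2$ be a $G_2$-fibration. If $(E_1\times E_1)\times(E_2\times E_2)$ is $(G_1\times G_2)$-completely normal, then $$\mathrm{TC}_{G_1\times G_2}[p_1\times p_2\colon E_1\times E_2\to B_1\times B_2]\le\mathrm{TC}_{G_1}[p_1\colon E_1\to B_1]+\mathrm{TC}_{G_2}[p_2\colon E_2\to B_2]-1,$$ where $G_i$ acts on $E_i\times E_i$ diagonally for $i=1,2$, and $G_1\times G_2$ acts on $(E_1\times E_1)\times(E_2\times E_2)$ componentwise.
   Context: All spaces are Hausdorff, $I=[0,1]$, path spaces carry the compact-open topology. A $G$-map is a continuous equivariant map; a $G$-homotopy is an equivariant homotopy ($G$ acting trivially on $I$). A $G$-fibration is a $G$-map with the $G$-homotopy lifting property with respect to every $G$-space. $G_1\times G_2$ acts componentwise on $E_1\times E_2$ and $B_1\times B_2$. A $G$-space $X$ is $G$-completely normal if for any two $G$-invariant subsets $A,A'$ of $X$ with $\overline{A}\cap A'=A\cap\overline{A'}=\emptyset$ there exist disjoint $G$-invariant open subsets of $X$ containing $A$ and $A'$, respectively. Equivariant sectional category: for a $G$-map $q\colon X\to Y$, $\mathrm{secat}_G(q)$ is the least positive integer $k$ such that $Y$ has a cover by $G$-invariant open sets $U_1,\dots,U_k$ with $G$-maps $s_i\colon U_i\to X$ such that $q\circ s_i$ is $G$-homotopic to the inclusion $U_i\hookrightarrow Y$ ($\infty$ if there is no such $k$). Equivariant parametrized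 topological complexity: for a $G$-fibration $p\colon E\to B$, let $E^I_B$ be the space of paths $\gamma\colon I\to E$ whose image lies in a single fibre of $p$, with $(g\cdot\gamma)(t)=g\cdot\gamma(t)$, and $E\times_B E=\{(e_1,e_2)\in E\times E: p(e_1)=p(e_2)\}$ with the diagonal action. The map $\Pi\colon E^I_B\to E\times_B E$, $\Pi(\gamma)=(\gamma(0),\gamma(1))$, is a $G$-fibration, and $\mathrm{TC}_G[p\colon E\to B]:=\mathrm{secat}_G(\Pi)$. *)

theory Defs
  imports "HOL-Analysis.Analysis" "HOL-Algebra.Group_Action"
begin

text \<open>
  Spaces are abstract topologies, and every space is Hausdorff.  An action is a curried function
  whose values outside the carrier of the group or outside the space are irrelevant.
\<close>

definition topological_group :: "('g, 'm) monoid_scheme \<Rightarrow> 'g topology \<Rightarrow> bool" where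
  "topological_group G T \<longleftrightarrow>
     group G \<and> topspace T = carrier G \<and> Hausdorff_space T \<and>
     continuous_map (prod_topology T T) T (\<lambda>(g, h). g \<otimes>\<^bsub>G\<^esub> h) \<and>
     continuous_map T T (\<lambda>g. inv\<^bsub>G\<^esub> g)"

text \<open>
  The library's \<open>group_action\<close> asks for extensional bijections, whence the \<open>restrict\<close>;
  \<open>group_action_restrict_iff\<close> below gives the usual axioms.
\<close>

definition G_space ::
    "('g, 'm) monoid_scheme \<Rightarrow> 'g topology \<Rightarrow> 'x topology \<Rightarrow> ('g \<Rightarrow> 'x \<Rightarrow> 'x) \<Rightarrow> bool" where
  "G_space G T X \<phi> \<longleftrightarrow>
     Hausdorff_space X \<and>
     group_action G (topspace X) (\<lambda>g. restrict (\<phi> g) (topspace X)) \<and>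
     continuous_map (prod_topology T X) X (\<lambda>(g, x). \<phi> g x)"

definition G_invariant :: "('g, 'm) monoid_scheme \<Rightarrow> ('g \<Rightarrow> 'x \<Rightarrow> 'x) \<Rightarrow> 'x set \<Rightarrow> bool" where
  "G_invariant G \<phi> A \<longleftrightarrow> (\<forall>g\<in>carrier G. \<phi> g ` A \<subseteq> A)"

definition equivariant ::
    "('g, 'm) monoid_scheme \<Rightarrow> 'x set \<Rightarrow> ('g \<Rightarrow> 'x \<Rightarrow> 'x) \<Rightarrow> ('g \<Rightarrow> 'y \<Rightarrow> 'y) \<Rightarrow> ('x \<Rightarrow> 'y) \<Rightarrow> bool" where
  "equivariant G S \<phi> \<psi> f \<longleftrightarrow> (\<forall>g\<in>carrier G. \<forall>x\<in>S. f (\<phi> g x) = \<psi> g (f x))"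

definition G_map ::
    "('g, 'm) monoid_scheme \<Rightarrow> 'x topology \<Rightarrow> ('g \<Rightarrow> 'x \<Rightarrow> 'x) \<Rightarrow> 'y topology \<Rightarrow> ('g \<Rightarrow> 'y \<Rightarrow> 'y) \<Rightarrow>
      ('x \<Rightarrow> 'y) \<Rightarrow> bool" where
  "G_map G X \<phi> Y \<psi> f \<longleftrightarrow> continuous_map X Y f \<and> equivariant G (topspace X) \<phi> \<psi> f"

abbreviation unit_interval :: "real topology" where
  "unit_interval \<equiv> top_of_set {0..1}"

text \<open>As for \<^const>\<open>homotopic_with\<close>, the cylinder is written with the interval on the left.\<close>

definition cylinder_action :: "('g \<Rightarrow> 'x \<Rightarrow> 'x) \<Rightarrow> 'g \<Rightarrow> real \<times> 'x \<Rightarrow> real \<times> 'x" where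
  "cylinder_action \<phi> g = (\<lambda>(t, x). (t, \<phi> g x))"

text \<open>
  An equivariant homotopy is one all of whose stages are equivariant;
  see \<open>G_homotopic_iff\<close> below.
\<close>

definition G_homotopic ::
    "('g, 'm) monoid_scheme \<Rightarrow> 'x topology \<Rightarrow> ('g \<Rightarrow> 'x \<Rightarrow> 'x) \<Rightarrow> 'y topology \<Rightarrow> ('g \<Rightarrow> 'y \<Rightarrow> 'y) \<Rightarrow>
      ('x \<Rightarrow> 'y) \<Rightarrow> ('x \<Rightarrow> 'y) \<Rightarrow> bool" where
  "G_homotopic G X \<phi> Y \<psi> = homotopic_with (equivariant G (topspace X) \<phi> \<psi>) X Y"

definition G_completely_normal ::
    "('g, 'm) monoid_scheme \<Rightarrow> 'x topology \<Rightarrow> ('g \<Rightarrow> 'x \<Rightarrow> 'x) \<Rightarrow> bool" where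
  "G_completely_normal G X \<phi> \<longleftrightarrow>
     (\<forall>A A'. G_invariant G \<phi> A \<and> G_invariant G \<phi> A' \<and> separatedin X A A' \<longrightarrow>
       (\<exists>U U'. openin X U \<and> openin X U' \<and> G_invariant G \<phi> U \<and> G_invariant G \<phi> U' \<and>
         A \<subseteq> U \<and> A' \<subseteq> U' \<and> disjnt U U'))"

definition diagonal_action :: "('g \<Rightarrow> 'x \<Rightarrow> 'x) \<Rightarrow> 'g \<Rightarrow> 'x \<times> 'x \<Rightarrow> 'x \<times> 'x" where
  "diagonal_action \<phi> g = map_prod (\<phi> g) (\<phi> g)"

definition product_action ::
    "('g \<Rightarrow> 'x \<Rightarrow> 'x) \<Rightarrow> ('h \<Rightarrow> 'y \<Rightarrow> 'y) \<Rightarrow> 'g \<times> 'h \<Rightarrow> 'x \<times> 'y \<Rightarrow> 'x \<times> 'y" where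
  "product_action \<phi> \<psi> = (\<lambda>(g, h). map_prod (\<phi> g) (\<psi> h))"

text \<open>
  Maps out of \<open>X\<close> are taken extensional, so that they are determined by their values on \<open>X\<close>.
\<close>

definition mapping_set :: "'x topology \<Rightarrow> 'y topology \<Rightarrow> ('x \<Rightarrow> 'y) set" where
  "mapping_set X Y = {f \<in> extensional (topspace X). continuous_map X Y f}"

definition compact_open_topology :: "'x topology \<Rightarrow> 'y topology \<Rightarrow> ('x \<Rightarrow> 'y) topology" where
  "compact_open_topology X Y =
     topology_generated_by
       {{f \<in> mapping_set X Y. f ` K \<subseteq> U} | K U. compactin X K \<and> openin Y U}"

abbreviation path_space_topology :: "'x topology \<Rightarrow> (real \<Rightarrow> 'x) topology" where
  "path_space_topology X \<equiv> compact_open_topology unit_interval X"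

definition path_action :: "('g \<Rightarrow> 'x \<Rightarrow> 'x) \<Rightarrow> 'g \<Rightarrow> (real \<Rightarrow> 'x) \<Rightarrow> real \<Rightarrow> 'x" where
  "path_action \<phi> g \<gamma> = (\<lambda>t\<in>{0..1}. \<phi> g (\<gamma> t))"

definition G_HLP ::
    "('g, 'm) monoid_scheme \<Rightarrow> 'x topology \<Rightarrow> ('g \<Rightarrow> 'x \<Rightarrow> 'x) \<Rightarrow>
      'e topology \<Rightarrow> ('g \<Rightarrow> 'e \<Rightarrow> 'e) \<Rightarrow> 'b topology \<Rightarrow> ('g \<Rightarrow> 'b \<Rightarrow> 'b) \<Rightarrow> ('e \<Rightarrow> 'b) \<Rightarrow> bool" where
  "G_HLP G X \<xi> E \<phi> B \<psi> p \<longleftrightarrow>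
     (\<forall>f h. G_map G X \<xi> E \<phi> f \<and>
            G_map G (prod_topology unit_interval X) (cylinder_action \<xi>) B \<psi> h \<and>
            (\<forall>x\<in>topspace X. h (0, x) = p (f x)) \<longrightarrow>
       (\<exists>H. G_map G (prod_topology unit_interval X) (cylinder_action \<xi>) E \<phi> H \<and>
            (\<forall>x\<in>topspace X. H (0, x) = f x) \<and>
            (\<forall>t\<in>{0..1}. \<forall>x\<in>topspace X. p (H (t, x)) = h (t, x))))"

text \<open>
  A definition cannot quantify over the types of the test spaces.  The type chosen here contains
  the universal test space, the pairs of a point \<open>e\<close> of \<open>E\<close> and a path in \<open>B\<close> starting at
  \<open>p e\<close>; \<open>G_fibration_imp_HLP\<close> below shows that the lifting property then holds with respect
  to G-spaces on every type.
\<close>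

definition G_fibration ::
    "('g, 'm) monoid_scheme \<Rightarrow> 'g topology \<Rightarrow> 'e topology \<Rightarrow> ('g \<Rightarrow> 'e \<Rightarrow> 'e) \<Rightarrow>
      'b topology \<Rightarrow> ('g \<Rightarrow> 'b \<Rightarrow> 'b) \<Rightarrow> ('e \<Rightarrow> 'b) \<Rightarrow> bool" where
  "G_fibration G T E \<phi> B \<psi> p \<longleftrightarrow>
     G_space G T E \<phi> \<and> G_space G T B \<psi> \<and> G_map G E \<phi> B \<psi> p \<and>
     (\<forall>(X :: ('e \<times> (real \<Rightarrow> 'b)) topology) \<xi>.
        G_space G T X \<xi> \<longrightarrow> G_HLP G X \<xi> E \<phi> B \<psi> p)"

text \<open>In \<^typ>\<open>enat\<close> the infimum of the empty set is \<open>\<infinity>\<close>.\<close>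

definition secat_G ::
    "('g, 'm) monoid_scheme \<Rightarrow> 'x topology \<Rightarrow> ('g \<Rightarrow> 'x \<Rightarrow> 'x) \<Rightarrow> 'y topology \<Rightarrow> ('g \<Rightarrow> 'y \<Rightarrow> 'y) \<Rightarrow>
      ('x \<Rightarrow> 'y) \<Rightarrow> enat" where
  "secat_G G X \<phi> Y \<psi> q =
     Inf {enat k | k. 1 \<le> k \<and>
       (\<exists>U s. (\<Union>i<k. U i) = topspace Y \<and>
          (\<forall>i<k. openin Y (U i) \<and> G_invariant G \<psi> (U i) \<and>
                 G_map G (subtopology Y (U i)) \<psi> X \<phi> (s i) \<and>
                 G_homotopic G (subtopology Y (U i)) \<psi> Y \<psi> (q \<circ> s i) id))}"

definition fibre_product :: "'e topology \<Rightarrow> ('e \<Rightarrow> 'b) \<Rightarrow> ('e \<times> 'e) topology" where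
  "fibre_product E p = subtopology (prod_topology E E) {(e, e'). p e = p e'}"

definition fibrewise_path_space ::
    "'e topology \<Rightarrow> 'b topology \<Rightarrow> ('e \<Rightarrow> 'b) \<Rightarrow> (real \<Rightarrow> 'e) topology" where
  "fibrewise_path_space E B p =
     subtopology (path_space_topology E) {\<gamma>. \<exists>b\<in>topspace B. \<forall>t\<in>{0..1}. p (\<gamma> t) = b}"

definition endpoint_map :: "(real \<Rightarrow> 'e) \<Rightarrow> 'e \<times> 'e" where
  "endpoint_map \<gamma> = (\<gamma> 0, \<gamma> 1)"

text \<open>The action on \<open>B\<close> does not enter beyond the equivariance of \<open>p\<close>.\<close>

definition TC_G ::
    "('g, 'm) monoid_scheme \<Rightarrow> 'e topology \<Rightarrow> ('g \<Rightarrow> 'e \<Rightarrow> 'e) \<Rightarrow> 'b topology \<Rightarrow> ('e \<Rightarrow> 'b) \<Rightarrow> enat" where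
  "TC_G G E \<phi> B p =
     secat_G G (fibrewise_path_space E B p) (path_action \<phi>)
       (fibre_product E p) (diagonal_action \<phi>) endpoint_map"

lemma group_action_restrict_iff:
  assumes "group G"
  shows "group_action G S (\<lambda>g. restrict (\<phi> g) S) \<longleftrightarrow>
     (\<forall>g\<in>carrier G. \<forall>x\<in>S. \<phi> g x \<in> S) \<and> (\<forall>x\<in>S. \<phi> \<one>\<^bsub>G\<^esub> x = x) \<and>
     (\<forall>g\<in>carrier G. \<forall>h\<in>carrier G. \<forall>x\<in>S. \<phi> (g \<otimes>\<^bsub>G\<^esub> h) x = \<phi> g (\<phi> h x))"
    (is "?L \<longleftrightarrow> ?R")
proof
  assume ?L
  then interpret group_action G S "\<lambda>g. restrict (\<phi> g) S" .
  have 1: "\<phi> g x \<in> S" if "g \<in> carrier G" "x \<in> S" for g x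
    using element_image[OF that refl] that by simp
  moreover have "\<phi> \<one>\<^bsub>G\<^esub> x = x" if "x \<in> S" for x
    using id_eq_one that by (metis restrict_apply')
  moreover have "\<phi> (g \<otimes>\<^bsub>G\<^esub> h) x = \<phi> g (\<phi> h x)"
    if "g \<in> carrier G" "h \<in> carrier G" "x \<in> S" for g h x
    using composition_rule[OF that(3,1,2)] that 1 by simp
  ultimately show ?R by blast
next
  assume R: ?R
  interpret group G by fact
  have inv: "\<phi> (inv\<^bsub>G\<^esub> g) (\<phi> g x) = x" "\<phi> g (\<phi> (inv\<^bsub>G\<^esub> g) x) = x"
    if "g \<in> carrier G" "x \<in> S" for g x
    using R that by (metis inv_closed l_inv, metis inv_closed r_inv)
  have bij: "restrict (\<phi> g) S \<in> Bij S" if g: "g \<in> carrier G" for g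
  proof -
    have "bij_betw (\<phi> g) S S"
      by (rule bij_betw_byWitness[where f' = "\<phi> (inv\<^bsub>G\<^esub> g)"]) (use R g inv in auto)
    then show ?thesis by (simp add: Bij_def bij_betw_def inj_on_restrict_eq)
  qed
  have "restrict (\<phi> (g \<otimes>\<^bsub>G\<^esub> h)) S =
      restrict (\<phi> g) S \<otimes>\<^bsub>BijGroup S\<^esub> restrict (\<phi> h) S"
    if "g \<in> carrier G" "h \<in> carrier G" for g h
    using that R bij by (auto simp: BijGroup_def compose_def fun_eq_iff)
  then have "(\<lambda>g. restrict (\<phi> g) S) \<in> hom G (BijGroup S)"
    using bij by (auto simp: hom_def BijGroup_def)
  then show ?L
    by (simp add: group_action_def group_hom_def group_hom_axioms_def group_BijGroup \<open>group G\<close>)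
qed

lemma G_homotopic_iff:
  assumes "\<And>g x. g \<in> carrier G \<Longrightarrow> x \<in> topspace X \<Longrightarrow> \<phi> g x \<in> topspace X"
  shows "G_homotopic G X \<phi> Y \<psi> f f' \<longleftrightarrow>
     (\<exists>h. G_map G (prod_topology unit_interval X) (cylinder_action \<phi>) Y \<psi> h \<and>
        (\<forall>x\<in>topspace X. h (0, x) = f x \<and> h (1, x) = f' x))"
proof -
  have 1: "equivariant G (topspace X) \<phi> \<psi> h \<longleftrightarrow> equivariant G (topspace X) \<phi> \<psi> k"
    if "\<And>x. x \<in> topspace X \<Longrightarrow> h x = k x" for h k
    unfolding equivariant_def by (intro ball_cong refl) (simp add: that assms)
  have 2: "G_map G (prod_topology unit_interval X) (cylinder_action \<phi>) Y \<psi> h \<longleftrightarrow>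
      continuous_map (prod_topology unit_interval X) Y h \<and>
      (\<forall>t\<in>{0..1}. equivariant G (topspace X) \<phi> \<psi> (\<lambda>x. h (t, x)))" for h
    unfolding G_map_def equivariant_def cylinder_action_def by auto
  show ?thesis
    unfolding G_homotopic_def 2 by (subst homotopic_with, rule 1, blast) blast
qed

lemma topspace_compact_open [simp]:
  "topspace (compact_open_topology X Y) = mapping_set X Y"
proof -
  have "mapping_set X Y \<in>
      {{f \<in> mapping_set X Y. f ` K \<subseteq> U} | K U. compactin X K \<and> openin Y U}"
    by (rule CollectI, rule exI[of _ "{}"]) auto
  then show ?thesis
    unfolding compact_open_topology_def topology_generated_by_topspace by auto
qed

lemma openin_compact_open:
  assumes "compactin X K" "openin Y U"
  shows "openin (compact_open_topology X Y) {f \<in> mapping_set X Y. f ` K \<subseteq> U}"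
  unfolding compact_open_topology_def
  by (rule topology_generated_by_Basis) (use assms in blast)

lemma Hausdorff_compact_open:
  assumes "Hausdorff_space Y"
  shows "Hausdorff_space (compact_open_topology X Y)"
  unfolding Hausdorff_space_def
proof (intro allI impI, elim conjE)
  fix f g assume f: "f \<in> topspace (compact_open_topology X Y)"
    and g: "g \<in> topspace (compact_open_topology X Y)" and "f \<noteq> g"
  then obtain x where x: "x \<in> topspace X" "f x \<noteq> g x"
    by (auto simp: mapping_set_def intro: extensionalityI)
  then have "f x \<in> topspace Y" "g x \<in> topspace Y"
    using f g by (auto simp: mapping_set_def continuous_map_def)
  then obtain U V where UV: "openin Y U" "openin Y V" "f x \<in> U" "g x \<in> V" "disjnt U V"
    using assms x by (metis Hausdorff_space_def)
  have K: "compactin X {x}" using x by simp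
  show "\<exists>U V. openin (compact_open_topology X Y) U \<and> openin (compact_open_topology X Y) V \<and>
      f \<in> U \<and> g \<in> V \<and> disjnt U V"
    by (rule exI[of _ "{f \<in> mapping_set X Y. f ` {x} \<subseteq> U}"],
        rule exI[of _ "{f \<in> mapping_set X Y. f ` {x} \<subseteq> V}"])
       (use openin_compact_open[OF K UV(1)] openin_compact_open[OF K UV(2)] UV f g in
         \<open>auto simp: disjnt_iff\<close>)
qed

lemma continuous_map_evaluation:
  assumes "locally_compact_space X" "Hausdorff_space X"
  shows "continuous_map (prod_topology X (compact_open_topology X Y)) Y (\<lambda>(x, f). f x)"
  unfolding continuous_map_def
proof (intro conjI allI impI)
  show "(\<lambda>(x, f). f x) \<in> topspace (prod_topology X (compact_open_topology X Y)) \<rightarrow> topspace Y"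
    by (auto simp: mapping_set_def continuous_map_def)
next
  fix V assume V: "openin Y V"
  let ?P = "prod_topology X (compact_open_topology X Y)"
  let ?S = "{z \<in> topspace ?P. (case z of (x, f) \<Rightarrow> f x) \<in> V}"
  show "openin ?P ?S"
  proof (subst openin_subopen, safe)
    fix x f assume xf: "(x, f) \<in> topspace ?P" "f x \<in> V"
    then have x: "x \<in> topspace X" and f: "f \<in> mapping_set X Y" by auto
    have "openin X {y \<in> topspace X. f y \<in> V}"
      using f V by (auto simp: mapping_set_def continuous_map_def)
    moreover have "neighbourhood_base_of (compactin X) X"
      using assms by (simp add: locally_compact_space_neighbourhood_base)
    ultimately obtain W K where WK: "openin X W" "compactin X K" "x \<in> W" "W \<subseteq> K"
        "K \<subseteq> {y \<in> topspace X. f y \<in> V}"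
      unfolding neighbourhood_base_of using x xf(2) by (metis (no_types, lifting) mem_Collect_eq)
    let ?T = "W \<times> {f \<in> mapping_set X Y. f ` K \<subseteq> V}"
    have "openin ?P ?T"
      using WK V by (simp add: openin_prod_Times_iff openin_compact_open)
    moreover have "(x, f) \<in> ?T" using WK f by auto
    moreover have "?T \<subseteq> ?S" using WK openin_subset[OF WK(1)] by (force simp: image_subset_iff)
    ultimately show "\<exists>T. openin ?P T \<and> (x, f) \<in> T \<and> T \<subseteq> ?S" by blast
  qed
qed

lemma continuous_map_curry:
  assumes F: "continuous_map (prod_topology X Z) Y F"
  shows "continuous_map Z (compact_open_topology X Y) (\<lambda>z. \<lambda>x\<in>topspace X. F (x, z))"
proof -
  let ?c = "\<lambda>z. \<lambda>x\<in>topspace X. F (x, z)"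
  have c: "?c z \<in> mapping_set X Y" if "z \<in> topspace Z" for z
  proof -
    have "continuous_map X Y (\<lambda>x. F (x, z))"
      using continuous_map_compose[OF _ F, of X "\<lambda>x. (x, z)"] that
      by (simp add: continuous_map_pairedI o_def)
    then show ?thesis
      by (auto simp: mapping_set_def elim: continuous_map_eq)
  qed
  show ?thesis
    unfolding compact_open_topology_def
  proof (rule continuous_on_generated_topo)
    fix S assume "S \<in> {{f \<in> mapping_set X Y. f ` K \<subseteq> U} |K U. compactin X K \<and> openin Y U}"
    then obtain K U where KU: "compactin X K" "openin Y U"
      and S: "S = {f \<in> mapping_set X Y. f ` K \<subseteq> U}" by blast
    have KX: "K \<subseteq> topspace X" using KU(1) by (rule compactin_subset_topspace)
    let ?W = "{w \<in> topspace (prod_topology X Z). F w \<in> U}"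
    have W: "openin (prod_topology X Z) ?W"
      using F KU(2) by (simp add: continuous_map_def)
    show "openin Z (?c -` S \<inter> topspace Z)"
    proof (subst openin_subopen, safe)
      fix z assume z: "z \<in> topspace Z" "?c z \<in> S"
      have KW: "K \<times> {z} \<subseteq> ?W"
      proof
        fix w assume "w \<in> K \<times> {z}"
        then obtain x where x: "w = (x, z)" "x \<in> K" by blast
        then have "?c z x \<in> U" "x \<in> topspace X" using z(2) KX by (auto simp: S)
        then show "w \<in> ?W" using z(1) x by simp
      qed
      obtain A C where AC: "openin X A" "openin Z C" "K \<subseteq> A" "z \<in> C" "A \<times> C \<subseteq> ?W"
        using tube_lemma_left[OF W KU(1) z(1) KW] by blast
      have "C \<subseteq> ?c -` S \<inter> topspace Z"
      proof
        fix y assume y: "y \<in> C"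
        then have "y \<in> topspace Z" using AC(2) openin_subset by blast
        moreover have "?c y x \<in> U" if "x \<in> K" for x
        proof -
          have "(x, y) \<in> ?W" using that y AC(3,5) by blast
          then show ?thesis using that KX by auto
        qed
        ultimately show "y \<in> ?c -` S \<inter> topspace Z"
          using c[of y] by (simp add: S image_subset_iff)
      qed
      then show "\<exists>T. openin Z T \<and> z \<in> T \<and> T \<subseteq> ?c -` S \<inter> topspace Z"
        using AC by auto
    qed
  next
    show "?c ` topspace Z \<subseteq> \<Union> {{f \<in> mapping_set X Y. f ` K \<subseteq> U} |K U. compactin X K \<and> openin Y U}"
      using c topspace_compact_open[of X Y]
      unfolding compact_open_topology_def topology_generated_by_topspace by blast
  qed
qed

lemma locally_compact_unit_interval: "locally_compact_space unit_interval"
  by (simp add: compact_imp_locally_compact_space compact_space_subtopology)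

lemma Hausdorff_unit_interval: "Hausdorff_space unit_interval"
  by (simp add: Hausdorff_space_subtopology)

lemma G_space_path_space:
  assumes "topological_group G T" "G_space G T B \<psi>"
  shows "G_space G T (path_space_topology B) (path_action \<psi>)"
proof -
  let ?P = "path_space_topology B"
  have G: "group G" and TG: "topspace T = carrier G"
    using assms by (auto simp: topological_group_def)
  have B: "\<forall>g\<in>carrier G. \<forall>x\<in>topspace B. \<psi> g x \<in> topspace B"
      "\<forall>x\<in>topspace B. \<psi> \<one>\<^bsub>G\<^esub> x = x"
      "\<forall>g\<in>carrier G. \<forall>h\<in>carrier G. \<forall>x\<in>topspace B. \<psi> (g \<otimes>\<^bsub>G\<^esub> h) x = \<psi> g (\<psi> h x)"
    using assms(2) by (simp_all add: G_space_def group_action_restrict_iff[OF G])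
  have cB: "continuous_map (prod_topology T B) B (\<lambda>(g, x). \<psi> g x)" and "Hausdorff_space B"
    using assms(2) by (simp_all add: G_space_def)
  let ?Z = "prod_topology unit_interval (prod_topology T ?P)"
  have 1: "continuous_map ?Z T (\<lambda>w. fst (snd w))"
    by (intro continuous_map_fst_of[unfolded o_def] continuous_map_compose[OF continuous_map_snd continuous_map_fst, unfolded o_def])
  have 2: "continuous_map ?Z (prod_topology unit_interval ?P) (\<lambda>w. (fst w, snd (snd w)))"
    by (intro continuous_map_pairedI continuous_map_fst
        continuous_map_compose[OF continuous_map_snd continuous_map_snd, unfolded o_def])
  have 3: "continuous_map ?Z B (\<lambda>w. snd (snd w) (fst w))"
    using continuous_map_compose[OF 2
        continuous_map_evaluation[OF locally_compact_unit_interval Hausdorff_unit_interval]]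
    by (simp add: o_def)
  have 4: "continuous_map ?Z B (\<lambda>w. \<psi> (fst (snd w)) (snd (snd w) (fst w)))"
    using continuous_map_compose[OF continuous_map_pairedI[OF 1 3] cB] by (simp add: o_def)
  have c: "continuous_map (prod_topology T ?P) ?P (\<lambda>(g, \<gamma>). path_action \<psi> g \<gamma>)"
    using continuous_map_curry[OF 4] by (simp add: path_action_def case_prod_unfold)
  have P: "\<gamma> t \<in> topspace B" if "\<gamma> \<in> mapping_set unit_interval B" "t \<in> {0..1}" for \<gamma> t
    using that by (auto simp: mapping_set_def continuous_map_def Pi_iff)
  have "path_action \<psi> g \<gamma> \<in> mapping_set unit_interval B"
    if "g \<in> carrier G" "\<gamma> \<in> mapping_set unit_interval B" for g \<gamma>
    using continuous_map_funspace[OF c] that TG by (auto simp: Pi_iff)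
  moreover have "path_action \<psi> \<one>\<^bsub>G\<^esub> \<gamma> = \<gamma>" if \<gamma>: "\<gamma> \<in> mapping_set unit_interval B" for \<gamma>
  proof (rule extensionalityI[of _ "{0..1}"])
    show "path_action \<psi> \<one>\<^bsub>G\<^esub> \<gamma> \<in> extensional {0..1}" by (simp add: path_action_def)
    show "\<gamma> \<in> extensional {0..1}" using \<gamma> by (simp add: mapping_set_def)
    show "path_action \<psi> \<one>\<^bsub>G\<^esub> \<gamma> t = \<gamma> t" if "t \<in> {0..1}" for t
      using B(2) P[OF \<gamma> that] that by (simp add: path_action_def)
  qed
  moreover have "path_action \<psi> (g \<otimes>\<^bsub>G\<^esub> h) \<gamma> = path_action \<psi> g (path_action \<psi> h \<gamma>)"
    if "g \<in> carrier G" "h \<in> carrier G" "\<gamma> \<in> mapping_set unit_interval B" for g h \<gamma>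
    using B(3) P that by (auto simp: path_action_def fun_eq_iff)
  ultimately show ?thesis
    using c Hausdorff_compact_open[OF \<open>Hausdorff_space B\<close>]
    by (simp add: G_space_def group_action_restrict_iff[OF G])
qed

lemma G_fibration_imp_HLP:
  fixes X :: "'x topology" and E :: "'e topology"
  assumes tg: "topological_group G T" and fib: "G_fibration G T E \<phi> B \<psi> p"
    and X: "G_space G T X \<xi>"
  shows "G_HLP G X \<xi> E \<phi> B \<psi> p"
  unfolding G_HLP_def
proof (intro allI impI, elim conjE)
  fix f :: "'x \<Rightarrow> 'e" and h
  assume f: "G_map G X \<xi> E \<phi> f"
    and h: "G_map G (prod_topology unit_interval X) (cylinder_action \<xi>) B \<psi> h"
    and hf: "\<forall>x\<in>topspace X. h (0, x) = p (f x)"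
  let ?P = "path_space_topology B"
  define W where "W = subtopology (prod_topology E ?P) {(e, \<beta>). \<beta> 0 = p e}"
  define \<omega> where "\<omega> = (\<lambda>g. map_prod (\<phi> g) (path_action \<psi> g))"
  have G: "group G" and TG: "topspace T = carrier G"
    using tg by (auto simp: topological_group_def)
  have E: "G_space G T E \<phi>" and B: "G_space G T B \<psi>" and p: "G_map G E \<phi> B \<psi> p"
    using fib by (auto simp: G_fibration_def)
  have P: "G_space G T ?P (path_action \<psi>)" by (rule G_space_path_space[OF tg B])
  note act = G_space_def group_action_restrict_iff[OF G]
  have tW: "topspace W = {(e, \<beta>). e \<in> topspace E \<and> \<beta> \<in> mapping_set unit_interval B \<and> \<beta> 0 = p e}"
    by (auto simp: W_def)
  have \<omega>W: "\<omega> g w \<in> topspace W" if "g \<in> carrier G" "w \<in> topspace W" for g w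
    using that E P p by (auto simp: act tW \<omega>_def G_map_def equivariant_def path_action_def)
  have "continuous_map (prod_topology T W) (prod_topology E ?P) (\<lambda>(g, w). \<omega> g w)"
  proof -
    have 0: "continuous_map (prod_topology T W) (prod_topology E ?P) snd"
      using continuous_map_snd[of T W] by (simp add: W_def continuous_map_in_subtopology)
    have 1: "continuous_map (prod_topology T W) E (\<lambda>z. fst (snd z))"
      using continuous_map_compose[OF 0 continuous_map_fst] by (simp add: o_def)
    have 2: "continuous_map (prod_topology T W) ?P (\<lambda>z. snd (snd z))"
      using continuous_map_compose[OF 0 continuous_map_snd] by (simp add: o_def)
    have 3: "continuous_map (prod_topology T E) E (\<lambda>(g, x). \<phi> g x)"
      "continuous_map (prod_topology T ?P) ?P (\<lambda>(g, x). path_action \<psi> g x)"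
      using E P by (auto simp: G_space_def)
    have "continuous_map (prod_topology T W) E (\<lambda>z. \<phi> (fst z) (fst (snd z)))"
      using continuous_map_compose[OF continuous_map_pairedI[OF continuous_map_fst 1] 3(1)]
      by (simp add: o_def)
    moreover have "continuous_map (prod_topology T W) ?P (\<lambda>z. path_action \<psi> (fst z) (snd (snd z)))"
      using continuous_map_compose[OF continuous_map_pairedI[OF continuous_map_fst 2] 3(2)]
      by (simp add: o_def)
    ultimately have "continuous_map (prod_topology T W) (prod_topology E ?P)
        (\<lambda>z. (\<phi> (fst z) (fst (snd z)), path_action \<psi> (fst z) (snd (snd z))))"
      by (rule continuous_map_pairedI)
    then show ?thesis
      by (simp add: \<omega>_def case_prod_unfold map_prod_def)
  qed
  then have "continuous_map (prod_topology T W) W (\<lambda>(g, w). \<omega> g w)"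
    using \<omega>W TG unfolding W_def continuous_map_in_subtopology
    by (fastforce simp: W_def)
  moreover have "Hausdorff_space W"
    using E P by (simp add: W_def G_space_def Hausdorff_space_subtopology Hausdorff_space_prod_topology)
  moreover have "\<omega> \<one>\<^bsub>G\<^esub> w = w" if "w \<in> topspace W" for w
    using that E P by (auto simp: act tW \<omega>_def)
  moreover have "\<omega> (g \<otimes>\<^bsub>G\<^esub> k) w = \<omega> g (\<omega> k w)"
    if "g \<in> carrier G" "k \<in> carrier G" "w \<in> topspace W" for g k w
    using that E P by (auto simp: act tW \<omega>_def)
  ultimately have W: "G_space G T W \<omega>"
    using \<omega>W by (simp add: act)
  have "G_HLP G W \<omega> E \<phi> B \<psi> p"
    using fib W by (auto simp: G_fibration_def)
  moreover have "G_map G W \<omega> E \<phi> fst"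
    using continuous_map_from_subtopology[OF continuous_map_fst]
    by (auto simp: G_map_def equivariant_def W_def \<omega>_def)
  moreover have "G_map G (prod_topology unit_interval W) (cylinder_action \<omega>) B \<psi> (\<lambda>(t, w). snd w t)"
  proof -
    have 0: "continuous_map (prod_topology unit_interval W) (prod_topology E ?P) snd"
      using continuous_map_snd[of unit_interval W]
      by (simp add: W_def continuous_map_in_subtopology)
    have "continuous_map (prod_topology unit_interval W) ?P (\<lambda>z. snd (snd z))"
      using continuous_map_compose[OF 0 continuous_map_snd] by (simp add: o_def)
    from continuous_map_compose[OF continuous_map_pairedI[OF continuous_map_fst this]
        continuous_map_evaluation[OF locally_compact_unit_interval Hausdorff_unit_interval]]
    have "continuous_map (prod_topology unit_interval W) B (\<lambda>(t, w). snd w t)"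
      by (simp add: o_def case_prod_unfold)
    then show ?thesis
      by (auto simp: G_map_def equivariant_def cylinder_action_def \<omega>_def path_action_def)
  qed
  ultimately obtain H where
      H: "G_map G (prod_topology unit_interval W) (cylinder_action \<omega>) E \<phi> H"
         "\<forall>w\<in>topspace W. H (0, w) = fst w"
         "\<forall>t\<in>{0..1}. \<forall>w\<in>topspace W. p (H (t, w)) = snd w t"
    unfolding G_HLP_def
    by (elim allE[of _ fst] allE[of _ "\<lambda>(t, w). snd w t"]) (auto simp: tW)
  define j where "j = (\<lambda>x. (f x, \<lambda>t\<in>{0..1}. h (t, x)))"
  have jt: "continuous_map X ?P (\<lambda>x. \<lambda>t\<in>{0..1}. h (t, x))"
    using continuous_map_curry[of unit_interval X B h] h by (simp add: G_map_def)
  then have "continuous_map X (prod_topology E ?P) j"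
    unfolding j_def using f by (intro continuous_map_pairedI) (auto simp: G_map_def)
  moreover have "j x \<in> {(e, \<beta>). \<beta> 0 = p e}" if "x \<in> topspace X" for x
    using that hf by (simp add: j_def)
  ultimately have j: "continuous_map X W j"
    by (auto simp: W_def continuous_map_in_subtopology)
  have jW: "j x \<in> topspace W" if "x \<in> topspace X" for x
    using j that by (auto simp: continuous_map_def)
  have jeq: "j (\<xi> g x) = \<omega> g (j x)" if "g \<in> carrier G" "x \<in> topspace X" for g x
    using that f h
    by (auto simp: j_def \<omega>_def G_map_def equivariant_def cylinder_action_def path_action_def
        fun_eq_iff)
  let ?H = "\<lambda>z. H (fst z, j (snd z))"
  have "continuous_map (prod_topology unit_interval X) (prod_topology unit_interval W)
      (\<lambda>z. (fst z, j (snd z)))"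
    by (intro continuous_map_pairedI continuous_map_fst
        continuous_map_compose[OF continuous_map_snd j, unfolded o_def])
  from continuous_map_compose[OF this] H(1)
  have "continuous_map (prod_topology unit_interval X) E ?H"
    by (auto simp: G_map_def o_def)
  moreover have "equivariant G (topspace (prod_topology unit_interval X)) (cylinder_action \<xi>) \<phi> ?H"
    using H(1) jW jeq by (auto simp: G_map_def equivariant_def cylinder_action_def)
  moreover have "\<forall>x\<in>topspace X. ?H (0, x) = f x"
    using H(2) jW by (auto simp: j_def)
  moreover have "p (?H (t, x)) = h (t, x)" if "t \<in> {0..1}" "x \<in> topspace X" for t x
    using H(3) that jW[of x] by (auto simp: j_def)
  ultimately show "\<exists>H. G_map G (prod_topology unit_interval X) (cylinder_action \<xi>) E \<phi> H \<and>
      (\<forall>x\<in>topspace X. H (0, x) = f x) \<and>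
      (\<forall>t\<in>{0..1}. \<forall>x\<in>topspace X. p (H (t, x)) = h (t, x))"
    unfolding G_map_def by blast
qed

end

theory Submission
  imports Defs
begin

text \<open>
  The argument is the one for the classical product inequality of sectional category, carried out
  equivariantly.  Over the base \<open>Y\<^sub>1 \<times> Y\<^sub>2\<close>, where \<open>Y\<^sub>i\<close> is the fibre product of
  \<open>E\<^sub>i\<close> with itself over \<open>B\<^sub>i\<close>, the boxes \<open>U\<^sub>i \<times> V\<^sub>j\<close> of two optimal covers
  carry product sections, but there are too many of them.  Replacing \<open>U\<^sub>i\<close> by the cell of points
  for which \<open>i\<close> is the first index of a set containing them, and likewise \<open>V\<^sub>j\<close>,
  gives a partition into invariant sets in which the products of cells with a fixed index sum
  \<open>i + j\<close> are pairwise separated (\<open>separatedin_disjointed_Times\<close>).  Equivariant complete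
  normality is inherited by the subspace \<open>Y\<^sub>1 \<times> Y\<^sub>2\<close> of
  \<open>(E\<^sub>1 \<times> E\<^sub>1) \<times> (E\<^sub>2 \<times> E\<^sub>2)\<close>, and it enlarges these products to
  disjoint invariant open sets inside their boxes (\<open>G_completely_normal_finite_family\<close>).  On a
  disjoint union of open sets the sections and homotopies can be glued, so each value of the index
  sum contributes one member of a cover (\<open>secat_G_prod_le\<close>).

  This bounds the sectional category of the product of the two endpoint maps.  It is the parametrized
  topological complexity of \<open>p\<^sub>1 \<times> p\<^sub>2\<close> up to a reordering of coordinates:
  the fibre product of \<open>p\<^sub>1 \<times> p\<^sub>2\<close> is \<open>Y\<^sub>1 \<times> Y\<^sub>2\<close> with the middle
  coordinates exchanged, and a pair of fibrewise paths is a fibrewise path of pairs.  Since a map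
  of total spaces covering a retraction of bases does not increase the sectional category
  (\<open>secat_G_le_retract\<close>), the bound carries over.
\<close>

section \<open>Separating finitely many invariant sets\<close>

lemma G_invariant_Int:
  "G_invariant G \<phi> A \<Longrightarrow> G_invariant G \<phi> B \<Longrightarrow> G_invariant G \<phi> (A \<inter> B)"
  unfolding G_invariant_def by blast

lemma G_invariant_UN:
  "(\<And>i. i \<in> I \<Longrightarrow> G_invariant G \<phi> (A i)) \<Longrightarrow> G_invariant G \<phi> (\<Union>i\<in>I. A i)"
  unfolding G_invariant_def by blast

lemma G_invariant_INT:
  "(\<And>i. i \<in> I \<Longrightarrow> G_invariant G \<phi> (A i)) \<Longrightarrow> G_invariant G \<phi> (\<Inter>i\<in>I. A i)"
  unfolding G_invariant_def by blast

lemma G_invariant_Times: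
  "G_invariant G \<phi> A \<Longrightarrow> G_invariant H \<psi> B \<Longrightarrow>
    G_invariant (G \<times>\<times> H) (product_action \<phi> \<psi>) (A \<times> B)"
  unfolding G_invariant_def product_action_def by (auto simp: image_subset_iff)

text \<open>A point of \<open>A\<close> moved into \<open>B\<close> would be moved back, within \<open>B\<close>, by the inverse element.\<close>

lemma G_invariant_Diff:
  assumes act: "group_action G S (\<lambda>g. restrict (\<phi> g) S)"
    and A: "G_invariant G \<phi> A" "A \<subseteq> S" and B: "G_invariant G \<phi> B"
  shows "G_invariant G \<phi> (A - B)"
  unfolding G_invariant_def
proof (intro ballI subsetI, elim imageE)
  fix g x y assume g: "g \<in> carrier G" and x: "x \<in> A - B" and y: "y = \<phi> g x"
  have G: "group G"
    using act by (simp add: group_action_def group_hom_def)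
  interpret group G by fact
  have "\<phi> (inv\<^bsub>G\<^esub> g) y = x"
    using act g x y A(2) unfolding group_action_restrict_iff[OF G]
    by (metis DiffD1 inv_closed l_inv subsetD)
  then have "y \<notin> B"
    using B g x unfolding G_invariant_def by (metis DiffD2 image_subset_iff inv_closed)
  then show "y \<in> A - B"
    using A(1) g x y unfolding G_invariant_def by blast
qed

text \<open>
  Separatedness of two subsets of an invariant subspace does not depend on the ambient space, so
  the separating sets can be found in the large space and cut down.
\<close>

lemma G_completely_normal_subtopology:
  assumes "G_completely_normal G X \<phi>" and S: "G_invariant G \<phi> S"
  shows "G_completely_normal G (subtopology X S) \<phi>"
  unfolding G_completely_normal_def separatedin_subtopology
proof (intro allI impI, elim conjE)
  fix A A' assume A: "G_invariant G \<phi> A" "G_invariant G \<phi> A'" "separatedin X A A'"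
    and AS: "A \<subseteq> S" "A' \<subseteq> S"
  obtain U U' where U: "openin X U" "openin X U'" "G_invariant G \<phi> U" "G_invariant G \<phi> U'"
      "A \<subseteq> U" "A' \<subseteq> U'" "disjnt U U'"
    using assms(1)[unfolded G_completely_normal_def, rule_format, of A A'] A by blast
  have "disjnt (U \<inter> S) (U' \<inter> S)" using U(7) by (auto simp: disjnt_iff)
  then show "\<exists>U U'. openin (subtopology X S) U \<and> openin (subtopology X S) U' \<and>
      G_invariant G \<phi> U \<and> G_invariant G \<phi> U' \<and> A \<subseteq> U \<and> A' \<subseteq> U' \<and> disjnt U U'"
    using U AS S by (intro exI[of _ "U \<inter> S"] exI[of _ "U' \<inter> S"] conjI
        openin_subtopology_Int G_invariant_Int Int_greatest)
qed

text \<open>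
  Separate each pair of members by disjoint sets and intersect, for each member, the finitely many
  sets obtained for it.
\<close>

lemma G_completely_normal_finite_family:
  assumes cn: "G_completely_normal G X \<phi>" and fin: "finite I"
    and inv: "\<And>i. i \<in> I \<Longrightarrow> G_invariant G \<phi> (A i)"
    and sep: "\<And>i j. i \<in> I \<Longrightarrow> j \<in> I \<Longrightarrow> i \<noteq> j \<Longrightarrow> separatedin X (A i) (A j)"
    and W: "\<And>i. i \<in> I \<Longrightarrow> openin X (W i) \<and> G_invariant G \<phi> (W i) \<and> A i \<subseteq> W i"
  obtains V where "\<And>i. i \<in> I \<Longrightarrow> openin X (V i)" "\<And>i. i \<in> I \<Longrightarrow> G_invariant G \<phi> (V i)"
    "\<And>i. i \<in> I \<Longrightarrow> A i \<subseteq> V i" "\<And>i. i \<in> I \<Longrightarrow> V i \<subseteq> W i" "disjoint_family_on V I"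
proof -
  define P where "P = (\<lambda>i j U U'. openin X U \<and> openin X U' \<and> G_invariant G \<phi> U \<and>
      G_invariant G \<phi> U' \<and> A i \<subseteq> U \<and> A j \<subseteq> U' \<and> disjnt U U')"
  have "\<exists>U U'. P i j U U'" if "i \<in> I" "j \<in> I" "i \<noteq> j" for i j
    using cn inv sep that unfolding G_completely_normal_def P_def by blast
  then obtain U U' where U: "\<And>i j. i \<in> I \<Longrightarrow> j \<in> I \<Longrightarrow> i \<noteq> j \<Longrightarrow> P i j (U i j) (U' i j)"
    by metis
  define V where "V = (\<lambda>i. W i \<inter> (\<Inter>j\<in>I - {i}. U i j \<inter> U' j i))"
  have V: "openin X (V i) \<and> G_invariant G \<phi> (V i) \<and> A i \<subseteq> V i" if i: "i \<in> I" for i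
  proof -
    have *: "openin X (U i j \<inter> U' j i) \<and> G_invariant G \<phi> (U i j \<inter> U' j i) \<and> A i \<subseteq> U i j \<inter> U' j i"
      if "j \<in> I - {i}" for j
      using U[of i j] U[of j i] i that by (auto simp: P_def G_invariant_Int)
    have "openin X (V i)"
    proof (cases "I - {i} = {}")
      case True
      then show ?thesis using W[OF i] by (simp only: V_def) simp
    next
      case False
      then have "openin X (\<Inter>j\<in>I - {i}. U i j \<inter> U' j i)"
        using * fin by (intro openin_INT2) auto
      then show ?thesis using W[OF i] by (auto simp: V_def)
    qed
    moreover have "G_invariant G \<phi> (V i)"
      unfolding V_def
      by (rule G_invariant_Int[OF _ G_invariant_INT]) (use * W[OF i] in blast)+
    moreover have "A i \<subseteq> V i"
      using * W[OF i] by (auto simp: V_def)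
    ultimately show ?thesis by blast
  qed
  moreover have "disjoint_family_on V I"
    unfolding disjoint_family_on_def
  proof (intro ballI impI)
    fix i j assume "i \<in> I" "j \<in> I" "i \<noteq> j"
    then have "V i \<subseteq> U i j" "V j \<subseteq> U' i j" "disjnt (U i j) (U' i j)"
      using U[of i j] by (auto simp: V_def P_def)
    then show "V i \<inter> V j = {}" by (auto simp: disjnt_iff)
  qed
  ultimately show ?thesis
    using that[of V] by (auto simp: V_def)
qed

section \<open>Invariant open sets with a section up to homotopy\<close>

text \<open>
  The condition on the members of the covers that define \<^const>\<open>secat_G\<close>, with the homotopy
  given as a map on the cylinder so that it can be restricted, multiplied and glued like the section.
\<close>

definition G_sectional ::
    "('g, 'm) monoid_scheme \<Rightarrow> 'x topology \<Rightarrow> ('g \<Rightarrow> 'x \<Rightarrow> 'x) \<Rightarrow> 'y topology \<Rightarrow> ('g \<Rightarrow> 'y \<Rightarrow> 'y) \<Rightarrow>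
      ('x \<Rightarrow> 'y) \<Rightarrow> 'y set \<Rightarrow> bool" where
  "G_sectional G X \<phi> Y \<psi> q U \<longleftrightarrow> openin Y U \<and> G_invariant G \<psi> U \<and>
     (\<exists>s h. G_map G (subtopology Y U) \<psi> X \<phi> s \<and>
        G_map G (prod_topology unit_interval (subtopology Y U)) (cylinder_action \<psi>) Y \<psi> h \<and>
        (\<forall>y\<in>U. h (0, y) = q (s y) \<and> h (1, y) = y))"

lemma G_sectional_iff:
  "G_sectional G X \<phi> Y \<psi> q U \<longleftrightarrow> openin Y U \<and> G_invariant G \<psi> U \<and>
     (\<exists>s. G_map G (subtopology Y U) \<psi> X \<phi> s \<and>
        G_homotopic G (subtopology Y U) \<psi> Y \<psi> (q \<circ> s) id)"
proof (cases "openin Y U \<and> G_invariant G \<psi> U")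
  case True
  then have t: "topspace (subtopology Y U) = U"
    using topspace_subtopology_subset[OF openin_subset, of Y U] by simp
  have "\<psi> g x \<in> U" if "g \<in> carrier G" "x \<in> U" for g x
    using True that by (auto simp: G_invariant_def image_subset_iff)
  then have "G_homotopic G (subtopology Y U) \<psi> Y \<psi> f f' \<longleftrightarrow>
      (\<exists>h. G_map G (prod_topology unit_interval (subtopology Y U)) (cylinder_action \<psi>) Y \<psi> h \<and>
        (\<forall>y\<in>U. h (0, y) = f y \<and> h (1, y) = f' y))" for f f'
    by (rule G_homotopic_iff[of G "subtopology Y U", unfolded t])
  then show ?thesis
    unfolding G_sectional_def by simp
qed (unfold G_sectional_def, blast)

lemma secat_G_eq_Inf:
  "secat_G G X \<phi> Y \<psi> q = Inf {enat k | k. 1 \<le> k \<and>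
     (\<exists>U. (\<Union>i<k. U i) = topspace Y \<and> (\<forall>i<k. G_sectional G X \<phi> Y \<psi> q (U i)))}"
proof -
  have "(\<exists>s. \<forall>i<k. openin Y (U i) \<and> G_invariant G \<psi> (U i) \<and>
           G_map G (subtopology Y (U i)) \<psi> X \<phi> (s i) \<and>
           G_homotopic G (subtopology Y (U i)) \<psi> Y \<psi> (q \<circ> s i) id) \<longleftrightarrow>
        (\<forall>i<k. G_sectional G X \<phi> Y \<psi> q (U i))" for k :: nat and U
    unfolding G_sectional_iff by metis
  then show ?thesis
    unfolding secat_G_def by simp
qed

lemma secat_G_le:
  fixes k :: nat
  assumes "1 \<le> k" "(\<Union>i<k. U i) = topspace Y" "\<And>i. i < k \<Longrightarrow> G_sectional G X \<phi> Y \<psi> q (U i)"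
  shows "secat_G G X \<phi> Y \<psi> q \<le> enat k"
  unfolding secat_G_eq_Inf
  by (intro Inf_lower CollectI exI[of _ k] exI[of _ U] conjI refl) (use assms in auto)

lemma secat_G_cases:
  obtains (infinite) "secat_G G X \<phi> Y \<psi> q = \<infinity>"
  | (cover) k U where "secat_G G X \<phi> Y \<psi> q = enat k" "1 \<le> k" "(\<Union>i<k. U i) = topspace Y"
      "\<And>i. i < k \<Longrightarrow> G_sectional G X \<phi> Y \<psi> q (U i)"
proof -
  let ?S = "{enat k | k. 1 \<le> k \<and>
     (\<exists>U. (\<Union>i<k. U i) = topspace Y \<and> (\<forall>i<k. G_sectional G X \<phi> Y \<psi> q (U i)))}"
  show ?thesis
  proof (cases "?S = {}")
    case True
    then have "secat_G G X \<phi> Y \<psi> q = \<infinity>"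
      unfolding secat_G_eq_Inf by (simp only: Inf_enat_def) simp
    then show ?thesis by (rule infinite)
  next
    case False
    then have "Inf ?S \<in> ?S" by (metis (no_types, lifting) ex_in_conv Inf_enat_def LeastI)
    then show ?thesis
      using cover unfolding secat_G_eq_Inf[symmetric] by blast
  qed
qed

lemma G_map_subset:
  assumes "G_map G (subtopology Y U) \<psi> X \<phi> f" "V \<subseteq> U"
  shows "G_map G (subtopology Y V) \<psi> X \<phi> f"
  using assms unfolding G_map_def equivariant_def
  by (auto intro: continuous_map_from_subtopology_mono)

lemma G_sectional_subset:
  assumes U: "G_sectional G X \<phi> Y \<psi> q U" and V: "openin Y V" "G_invariant G \<psi> V" "V \<subseteq> U"
  shows "G_sectional G X \<phi> Y \<psi> q V"
proof -
  obtain s h where s: "G_map G (subtopology Y U) \<psi> X \<phi> s"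
    and h: "G_map G (prod_topology unit_interval (subtopology Y U)) (cylinder_action \<psi>) Y \<psi> h"
      "\<forall>y\<in>U. h (0, y) = q (s y) \<and> h (1, y) = y"
    using U unfolding G_sectional_def by blast
  have "G_map G (prod_topology unit_interval (subtopology Y V)) (cylinder_action \<psi>) Y \<psi> h"
    using h(1) V(3) unfolding prod_topology_subtopology(2)[of _ Y] by (elim G_map_subset) auto
  then show ?thesis
    using V h(2) G_map_subset[OF s V(3)] unfolding G_sectional_def by blast
qed

text \<open>
  Gluing keeps equivariance because the group does not move a point from one member to another.
\<close>

lemma G_map_glue:
  assumes opn: "\<And>i. i \<in> I \<Longrightarrow> openin Y (V i)"
    and inv: "\<And>i. i \<in> I \<Longrightarrow> G_invariant G \<psi> (V i)"
    and disj: "disjoint_family_on V I"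
    and f: "\<And>i. i \<in> I \<Longrightarrow> G_map G (subtopology Y (V i)) \<psi> X \<phi> (f i)"
  obtains F where "G_map G (subtopology Y (\<Union>i\<in>I. V i)) \<psi> X \<phi> F"
    "\<And>i y. i \<in> I \<Longrightarrow> y \<in> V i \<Longrightarrow> F y = f i y"
proof -
  let ?Y = "subtopology Y (\<Union>i\<in>I. V i)"
  have VY: "V i \<subseteq> topspace Y" if "i \<in> I" for i
    using opn[OF that] by (rule openin_subset)
  then have tY: "topspace ?Y = (\<Union>i\<in>I. V i)" by auto
  have sub: "subtopology ?Y (V i) = subtopology Y (V i)" if "i \<in> I" for i
    unfolding subtopology_subtopology using that by (metis Int_absorb1 UN_upper)
  obtain F where F: "continuous_map ?Y X F"
    "\<And>y i. \<lbrakk>i \<in> I; y \<in> topspace ?Y \<inter> V i\<rbrakk> \<Longrightarrow> F y = f i y"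
  proof (rule pasting_lemma_exists[where X = ?Y and I = I and T = V and f = f and Y = X])
    show "openin ?Y (V i)" if "i \<in> I" for i
      using opn[OF that] that by (metis UN_upper openin_subset_topspace_eq openin_subtopology_Int Int_absorb2)
    show "continuous_map (subtopology ?Y (V i)) X (f i)" if "i \<in> I" for i
      using f[OF that] unfolding sub[OF that] G_map_def by blast
    show "f i x = f j x" if "i \<in> I" "j \<in> I" "x \<in> topspace ?Y \<inter> V i \<inter> V j" for i j x
      using that disj unfolding disjoint_family_on_def by (cases "i = j") auto
  qed (auto simp: tY)
  have F': "F y = f i y" if "i \<in> I" "y \<in> V i" for i y
    using F(2)[of i y] that tY by blast
  have "F (\<psi> g y) = \<phi> g (F y)" if "g \<in> carrier G" "i \<in> I" "y \<in> V i" for g i y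
  proof -
    have "\<psi> g y \<in> V i" using inv that unfolding G_invariant_def by blast
    then show ?thesis
      using f[of i] that VY[of i] unfolding G_map_def equivariant_def
      by (auto simp: F'[OF that(2)])
  qed
  then have "equivariant G (topspace ?Y) \<psi> \<phi> F"
    unfolding equivariant_def tY by blast
  then show ?thesis
    using that[of F] F(1) F' unfolding G_map_def by blast
qed

text \<open>
  The members of a disjoint family need not agree on any overlap, and the cylinders over them are
  again disjoint, open and invariant; so the sections and the homotopies are glued in the same way.
\<close>

lemma G_sectional_disjoint_UN:
  assumes sec: "\<And>i. i \<in> I \<Longrightarrow> G_sectional G X \<phi> Y \<psi> q (V i)" and disj: "disjoint_family_on V I"
  shows "G_sectional G X \<phi> Y \<psi> q (\<Union>i\<in>I. V i)"
proof -
  have V: "openin Y (V i)" "G_invariant G \<psi> (V i)" if "i \<in> I" for i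
    using sec[OF that] unfolding G_sectional_def by blast+
  have times_UN: "{0..1::real} \<times> (\<Union>i\<in>I. V i) = (\<Union>i\<in>I. {0..1} \<times> V i)" by blast
  have cyl: "prod_topology unit_interval (subtopology Y S) =
      subtopology (prod_topology unit_interval Y) ({0..1} \<times> S)" for S
    by (simp add: prod_topology_subtopology(2))
  obtain s h where s: "\<And>i. i \<in> I \<Longrightarrow> G_map G (subtopology Y (V i)) \<psi> X \<phi> (s i)"
    and h: "\<And>i. i \<in> I \<Longrightarrow> G_map G (subtopology (prod_topology unit_interval Y) ({0..1} \<times> V i))
        (cylinder_action \<psi>) Y \<psi> (h i)"
    and ends: "\<And>i y. i \<in> I \<Longrightarrow> y \<in> V i \<Longrightarrow> h i (0, y) = q (s i y) \<and> h i (1, y) = y"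
    using sec unfolding G_sectional_def cyl by metis
  obtain F where F: "G_map G (subtopology Y (\<Union>i\<in>I. V i)) \<psi> X \<phi> F"
    "\<And>i y. i \<in> I \<Longrightarrow> y \<in> V i \<Longrightarrow> F y = s i y"
    using G_map_glue[OF V disj s] by blast
  obtain H where H: "G_map G (subtopology (prod_topology unit_interval Y) (\<Union>i\<in>I. {0..1} \<times> V i))
      (cylinder_action \<psi>) Y \<psi> H"
    "\<And>i z. i \<in> I \<Longrightarrow> z \<in> {0..1} \<times> V i \<Longrightarrow> H z = h i z"
  proof (rule G_map_glue[where I = I and V = "\<lambda>i. {0..1} \<times> V i" and f = h, OF _ _ _ h])
    show "openin (prod_topology unit_interval Y) ({0..1} \<times> V i)" if "i \<in> I" for i
      using V(1)[OF that] by (simp add: openin_prod_Times_iff)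
    show "G_invariant G (cylinder_action \<psi>) ({0..1} \<times> V i)" if "i \<in> I" for i
      using V(2)[OF that] unfolding G_invariant_def cylinder_action_def by auto
    show "disjoint_family_on (\<lambda>i. {0..1::real} \<times> V i) I"
      using disj unfolding disjoint_family_on_def by blast
  qed blast+
  have "G_map G (prod_topology unit_interval (subtopology Y (\<Union>i\<in>I. V i))) (cylinder_action \<psi>) Y \<psi> H"
    unfolding cyl times_UN using H(1) .
  moreover have "\<forall>y\<in>(\<Union>i\<in>I. V i). H (0, y) = q (F y) \<and> H (1, y) = y"
    using F(2) H(2) ends by auto
  ultimately show ?thesis
    using F(1) V unfolding G_sectional_def by (auto intro: G_invariant_UN)
qed

lemma G_sectional_Times:
  assumes U: "G_sectional G X \<phi> Y \<psi> q U" and V: "G_sectional G' X' \<phi>' Y' \<psi>' q' V"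
  shows "G_sectional (G \<times>\<times> G') (prod_topology X X') (product_action \<phi> \<phi>')
    (prod_topology Y Y') (product_action \<psi> \<psi>') (map_prod q q') (U \<times> V)"
proof -
  obtain s h where s: "G_map G (subtopology Y U) \<psi> X \<phi> s"
    and h: "G_map G (prod_topology unit_interval (subtopology Y U)) (cylinder_action \<psi>) Y \<psi> h"
      "\<forall>y\<in>U. h (0, y) = q (s y) \<and> h (1, y) = y"
    using U unfolding G_sectional_def by blast
  obtain s' h' where s': "G_map G' (subtopology Y' V) \<psi>' X' \<phi>' s'"
    and h': "G_map G' (prod_topology unit_interval (subtopology Y' V)) (cylinder_action \<psi>') Y' \<psi>' h'"
      "\<forall>y\<in>V. h' (0, y) = q' (s' y) \<and> h' (1, y) = y"
    using V unfolding G_sectional_def by blast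
  let ?Y = "prod_topology (subtopology Y U) (subtopology Y' V)"
  let ?Z = "prod_topology unit_interval ?Y"
  let ?h = "\<lambda>(t, y, y'). (h (t, y), h' (t, y'))"
  have "continuous_map ?Y (prod_topology X X') (map_prod s s')"
    unfolding map_prod_def using s s'
    by (intro continuous_map_prod_top[THEN iffD2]) (auto simp: G_map_def)
  then have S: "G_map (G \<times>\<times> G') ?Y (product_action \<psi> \<psi>') (prod_topology X X')
      (product_action \<phi> \<phi>') (map_prod s s')"
    using s s' by (auto simp: G_map_def equivariant_def product_action_def)
  have 1: "continuous_map ?Z (subtopology Y U) (\<lambda>z. fst (snd z))"
      "continuous_map ?Z (subtopology Y' V) (\<lambda>z. snd (snd z))"
    using continuous_map_compose[OF continuous_map_snd continuous_map_fst]
      continuous_map_compose[OF continuous_map_snd continuous_map_snd] by (auto simp: o_def)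
  have "continuous_map ?Z Y (\<lambda>z. h (fst z, fst (snd z)))"
    using continuous_map_compose[OF continuous_map_pairedI[OF continuous_map_fst 1(1)]] h(1)
    by (auto simp: G_map_def o_def)
  moreover have "continuous_map ?Z Y' (\<lambda>z. h' (fst z, snd (snd z)))"
    using continuous_map_compose[OF continuous_map_pairedI[OF continuous_map_fst 1(2)]] h'(1)
    by (auto simp: G_map_def o_def)
  ultimately have "continuous_map ?Z (prod_topology Y Y') ?h"
    using continuous_map_pairedI unfolding case_prod_unfold by blast
  then have H: "G_map (G \<times>\<times> G') ?Z (cylinder_action (product_action \<psi> \<psi>')) (prod_topology Y Y')
      (product_action \<psi> \<psi>') ?h"
    using h(1) h'(1)
    by (auto simp: G_map_def equivariant_def product_action_def cylinder_action_def)
  have "openin (prod_topology Y Y') (U \<times> V)"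
    using U V by (simp add: G_sectional_def openin_prod_Times_iff)
  moreover have "G_invariant (G \<times>\<times> G') (product_action \<psi> \<psi>') (U \<times> V)"
    using U V by (simp add: G_sectional_def G_invariant_Times)
  moreover have "\<forall>z\<in>U \<times> V. ?h (0, z) = map_prod q q' (map_prod s s' z) \<and> ?h (1, z) = z"
    using h(2) h'(2) by auto
  ultimately show ?thesis
    using S H unfolding G_sectional_def subtopology_Times by blast
qed

section \<open>The product inequality for the sectional category\<close>

lemma openin_disjoint_closure_of_disjointed:
  assumes "openin Y (U i)" "i < j"
  shows "U i \<inter> Y closure_of disjointed U j = {}"
  using assms by (subst openin_Int_closure_of_eq_empty) (auto simp: disjointed_def)

text \<open>
  On the antidiagonal \<open>i + j = const\<close> two different pairs are ordered oppositely by their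
  coordinates, so each of the two cells misses the closure of the other in the coordinate where its
  own index is the smaller one.
\<close>

lemma separatedin_disjointed_Times:
  fixes U :: "nat \<Rightarrow> 'y set" and U' :: "nat \<Rightarrow> 'z set"
  assumes U: "\<And>l. l \<in> {i, i'} \<Longrightarrow> openin Y (U l)" and U': "\<And>l. l \<in> {j, j'} \<Longrightarrow> openin Y' (U' l)"
    and eq: "i + j = i' + j'" and ne: "(i, j) \<noteq> (i', j')"
  shows "separatedin (prod_topology Y Y') (disjointed U i \<times> disjointed U' j)
    (disjointed U i' \<times> disjointed U' j')"
proof -
  have *: "disjointed U a \<inter> Y closure_of disjointed U b = {} \<and>
      disjointed U' d \<inter> Y' closure_of disjointed U' c = {}"
    if "openin Y (U a)" "openin Y' (U' d)" "a < b" "d < c" for a b c d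
    using that openin_disjoint_closure_of_disjointed[of Y U a b]
      openin_disjoint_closure_of_disjointed[of Y' U' d c] disjointed_subset[of U a]
      disjointed_subset[of U' d] by blast
  have sub: "disjointed U i \<subseteq> topspace Y" "disjointed U i' \<subseteq> topspace Y"
      "disjointed U' j \<subseteq> topspace Y'" "disjointed U' j' \<subseteq> topspace Y'"
    using disjointed_subset U U' openin_subset by (metis insertCI order_trans)+
  consider "i < i'" "j' < j" | "i' < i" "j < j'" using eq ne by fastforce
  then show ?thesis
  proof cases
    case 1
    then show ?thesis
      using *[of i j' i' j] U U' sub unfolding separatedin_def closure_of_Times by auto
  next
    case 2
    then show ?thesis
      using *[of i' j i j'] U U' sub unfolding separatedin_def closure_of_Times by auto
  qed
qed

text \<open>
  Given covers by \<open>k\<close> sets \<open>U i\<close> and by \<open>k'\<close> sets \<open>U' j\<close>, the products of the cells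
  \<open>disjointed U i\<close> and \<open>disjointed U' j\<close> partition the product of the bases.  Those
  with \<open>i + j = s\<close> are pairwise separated, hence lie in disjoint invariant open subsets of
  the boxes \<open>U i \<times> U' j\<close>, and the union \<open>W s\<close> of these open sets is again
  sectional.  The sum \<open>s\<close> takes only the \<open>k + k' - 1\<close> values
  \<open>0, \<dots>, k + k' - 2\<close>, which is where the bound improves on \<open>k * k'\<close>.
\<close>

lemma secat_G_prod_le:
  assumes act: "group_action G (topspace Y) (\<lambda>g. restrict (\<psi> g) (topspace Y))"
    and act': "group_action G' (topspace Y') (\<lambda>g. restrict (\<psi>' g) (topspace Y'))"
    and cn: "G_completely_normal (G \<times>\<times> G') (prod_topology Y Y') (product_action \<psi> \<psi>')"
  shows "secat_G (G \<times>\<times> G') (prod_topology X X') (product_action \<phi> \<phi>')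
      (prod_topology Y Y') (product_action \<psi> \<psi>') (map_prod q q')
    \<le> secat_G G X \<phi> Y \<psi> q + secat_G G' X' \<phi>' Y' \<psi>' q' - 1"
    (is "?s \<le> _")
proof (cases rule: secat_G_cases[of G X \<phi> Y \<psi> q])
  case infinite
  then show ?thesis by simp
next
  case kU: (cover k U)
  show ?thesis
  proof (cases rule: secat_G_cases[of G' X' \<phi>' Y' \<psi>' q'])
    case infinite
    then show ?thesis by simp
  next
    case kU': (cover k' U')
    let ?Y = "prod_topology Y Y'" and ?H = "G \<times>\<times> G'" and ?\<psi> = "product_action \<psi> \<psi>'"
    let ?sec = "G_sectional ?H (prod_topology X X') (product_action \<phi> \<phi>') ?Y ?\<psi> (map_prod q q')"
    have U: "openin Y (U i)" "G_invariant G \<psi> (U i)" if "i < k" for i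
      using kU(4)[OF that] by (auto simp: G_sectional_def)
    have U': "openin Y' (U' i)" "G_invariant G' \<psi>' (U' i)" if "i < k'" for i
      using kU'(4)[OF that] by (auto simp: G_sectional_def)
    have inv: "G_invariant G \<psi> (disjointed U i)" if "i < k" for i
      unfolding disjointed_def using that U
      by (intro G_invariant_Diff[OF act] G_invariant_UN openin_subset) auto
    have inv': "G_invariant G' \<psi>' (disjointed U' i)" if "i < k'" for i
      unfolding disjointed_def using that U'
      by (intro G_invariant_Diff[OF act'] G_invariant_UN openin_subset) auto
    define R where "R = (\<lambda>s. {(i, j). i < k \<and> j < k' \<and> i + j = s})"
    define A where "A = (\<lambda>(i, j). disjointed U i \<times> disjointed U' j)"
    have "\<exists>W. ?sec W \<and> (\<forall>r\<in>R s. A r \<subseteq> W)" for s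
    proof -
      have fin: "finite (R s)"
        by (rule finite_subset[of _ "{..<k} \<times> {..<k'}"]) (auto simp: R_def)
      have invA: "G_invariant ?H ?\<psi> (A r)" if "r \<in> R s" for r
        using that inv inv' by (auto simp: R_def A_def intro: G_invariant_Times)
      have sepA: "separatedin ?Y (A r) (A r')" if "r \<in> R s" "r' \<in> R s" "r \<noteq> r'" for r r'
        using that U(1) U'(1) unfolding R_def A_def
        by (auto intro!: separatedin_disjointed_Times)
      have box: "?sec (U (fst r) \<times> U' (snd r))" if "r \<in> R s" for r
        using that kU(4) kU'(4) by (auto simp: R_def intro: G_sectional_Times)
      have sub: "A r \<subseteq> U (fst r) \<times> U' (snd r)" for r
        using disjointed_subset[of U "fst r"] disjointed_subset[of U' "snd r"]
        by (auto simp: A_def split: prod.split)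
      have boxA: "openin ?Y (U (fst r) \<times> U' (snd r)) \<and>
          G_invariant ?H ?\<psi> (U (fst r) \<times> U' (snd r)) \<and> A r \<subseteq> U (fst r) \<times> U' (snd r)"
        if "r \<in> R s" for r
        using box[OF that] sub[of r] unfolding G_sectional_def by blast
      obtain V where V: "\<And>r. r \<in> R s \<Longrightarrow> openin ?Y (V r)" "\<And>r. r \<in> R s \<Longrightarrow> G_invariant ?H ?\<psi> (V r)"
          "\<And>r. r \<in> R s \<Longrightarrow> A r \<subseteq> V r" "\<And>r. r \<in> R s \<Longrightarrow> V r \<subseteq> U (fst r) \<times> U' (snd r)"
          "disjoint_family_on V (R s)"
        by (rule G_completely_normal_finite_family[where I = "R s" and A = A and
              W = "\<lambda>r. U (fst r) \<times> U' (snd r)", OF cn fin invA sepA boxA], assumption+, rule that)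
      have "?sec (\<Union>r\<in>R s. V r)"
        by (rule G_sectional_disjoint_UN[OF G_sectional_subset[OF box V(1,2,4)] V(5)])
      then show ?thesis using V(3) by blast
    qed
    then have "\<exists>W. \<forall>s. ?sec (W s) \<and> (\<forall>r\<in>R s. A r \<subseteq> W s)"
      by (intro choice allI)
    then obtain W where W: "\<And>s. ?sec (W s)" "\<And>s r. r \<in> R s \<Longrightarrow> A r \<subseteq> W s" by blast
    have "topspace ?Y \<subseteq> (\<Union>s<k + k' - 1. W s)"
    proof
      fix z assume "z \<in> topspace ?Y"
      then obtain y y' where z: "z = (y, y')" and y: "y \<in> (\<Union>i<k. U i)" "y' \<in> (\<Union>i<k'. U' i)"
        unfolding kU(3) kU'(3) by auto
      have "y \<in> (\<Union>i\<in>{0..<k}. disjointed U i)" "y' \<in> (\<Union>i\<in>{0..<k'}. disjointed U' i)"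
        using y unfolding finite_UN_disjointed_eq by (auto simp: atLeast0LessThan)
      then obtain i j where ij: "i < k" "j < k'" "z \<in> A (i, j)"
        by (auto simp: A_def z)
      then have "z \<in> W (i + j)" using W(2)[of "(i, j)" "i + j"] by (auto simp: R_def)
      then show "z \<in> (\<Union>s<k + k' - 1. W s)" using ij by fastforce
    qed
    moreover have "W s \<subseteq> topspace ?Y" for s
      by (rule openin_subset) (use W(1)[of s] in \<open>simp only: G_sectional_def\<close>)
    ultimately have "?s \<le> enat (k + k' - 1)"
      using kU(2) kU'(2) by (intro secat_G_le[where U = W] W(1) equalityI UN_least) auto
    then show ?thesis
      by (simp add: kU(1) kU'(1) one_enat_def)
  qed
qed

section \<open>Transfer along a retraction of the base\<close>

text \<open>
  A section \<open>s\<close> over \<open>U\<close> becomes \<open>\<Phi> \<circ> s \<circ> \<Theta>\<close> over the preimage of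
  \<open>U\<close>, and conjugating the homotopy with \<open>\<Psi>\<close> and \<open>\<Theta>\<close> makes it end at
  \<open>\<Psi> \<circ> \<Theta>\<close>, which is the identity.
\<close>

lemma secat_G_le_retract:
  assumes \<Phi>: "G_map G X \<phi> X' \<phi>' \<Phi>" and \<Psi>: "G_map G Y \<psi> Y' \<psi>' \<Psi>"
    and \<Theta>: "G_map G Y' \<psi>' Y \<psi> \<Theta>" and inv: "G_invariant G \<psi>' (topspace Y')"
    and retr: "\<And>y. y \<in> topspace Y' \<Longrightarrow> \<Psi> (\<Theta> y) = y"
    and comm: "\<And>x. x \<in> topspace X \<Longrightarrow> q' (\<Phi> x) = \<Psi> (q x)"
  shows "secat_G G X' \<phi>' Y' \<psi>' q' \<le> secat_G G X \<phi> Y \<psi> q"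
proof (cases rule: secat_G_cases[of G X \<phi> Y \<psi> q])
  case infinite
  then show ?thesis by simp
next
  case (cover k U)
  define V where "V = (\<lambda>i. {y \<in> topspace Y'. \<Theta> y \<in> U i})"
  have \<Theta>Y: "\<Theta> y \<in> topspace Y" if "y \<in> topspace Y'" for y
    using \<Theta> that by (auto simp: G_map_def continuous_map_def)
  have "G_sectional G X' \<phi>' Y' \<psi>' q' (V i)" if i: "i < k" for i
  proof -
    let ?U = "subtopology Y (U i)" and ?V = "subtopology Y' (V i)"
    obtain s h where U: "openin Y (U i)" "G_invariant G \<psi> (U i)"
      and s: "continuous_map ?U X s" "equivariant G (topspace ?U) \<psi> \<phi> s"
      and h: "continuous_map (prod_topology unit_interval ?U) Y h"
        "equivariant G (topspace (prod_topology unit_interval ?U)) (cylinder_action \<psi>) \<psi> h"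
        "\<forall>y\<in>U i. h (0, y) = q (s y) \<and> h (1, y) = y"
      using cover(4)[OF i] unfolding G_sectional_def G_map_def by blast
    have tU: "topspace ?U = U i" using openin_subset[OF U(1)] by auto
    have tV: "topspace ?V = V i" by (auto simp: V_def)
    have V: "openin Y' (V i)"
      using \<Theta> U(1) unfolding V_def G_map_def continuous_map_def by blast
    have Vinv: "G_invariant G \<psi>' (V i)"
      using inv U(2) \<Theta> unfolding V_def G_invariant_def G_map_def equivariant_def
      by (auto simp: image_subset_iff)
    have \<Theta>V: "continuous_map ?V ?U \<Theta>"
      using \<Theta> by (auto simp: G_map_def V_def continuous_map_in_subtopology
          continuous_map_from_subtopology)
    have \<Theta>eq: "\<Theta> (\<psi>' g y) = \<psi> g (\<Theta> y)" "\<Theta> y \<in> U i" if "g \<in> carrier G" "y \<in> V i" for g y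
      using \<Theta> that by (auto simp: G_map_def equivariant_def V_def)
    have sX: "s y \<in> topspace X" if "y \<in> U i" for y
      using s(1) that tU by (auto simp: continuous_map_def)
    have hY: "h (t, y) \<in> topspace Y" if "t \<in> {0..1}" "y \<in> U i" for t y
      using h(1) that tU by (auto simp: continuous_map_def Pi_iff)
    have "continuous_map ?V X' (\<lambda>y. \<Phi> (s (\<Theta> y)))"
      using continuous_map_compose[OF continuous_map_compose[OF \<Theta>V s(1)], of X' \<Phi>] \<Phi>
      by (simp add: G_map_def o_def)
    moreover have "equivariant G (topspace ?V) \<psi>' \<phi>' (\<lambda>y. \<Phi> (s (\<Theta> y)))"
      using \<Phi> s(2) \<Theta>eq sX unfolding G_map_def equivariant_def tU tV by simp
    moreover have "continuous_map (prod_topology unit_interval ?V) Y' (\<lambda>(t, y). \<Psi> (h (t, \<Theta> y)))"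
    proof -
      have "continuous_map (prod_topology unit_interval ?V) (prod_topology unit_interval ?U)
          (\<lambda>z. (fst z, \<Theta> (snd z)))"
        using continuous_map_compose[OF continuous_map_snd \<Theta>V]
        by (intro continuous_map_pairedI continuous_map_fst) (simp add: o_def)
      from continuous_map_compose[OF continuous_map_compose[OF this h(1)], of Y' \<Psi>] \<Psi>
      show ?thesis by (simp add: G_map_def o_def case_prod_unfold)
    qed
    moreover have "equivariant G (topspace (prod_topology unit_interval ?V)) (cylinder_action \<psi>') \<psi>'
        (\<lambda>(t, y). \<Psi> (h (t, \<Theta> y)))"
      using \<Psi> h(2) \<Theta>eq hY tU tV unfolding G_map_def equivariant_def cylinder_action_def by simp
    moreover have "\<forall>y\<in>V i. \<Psi> (h (0, \<Theta> y)) = q' (\<Phi> (s (\<Theta> y))) \<and> \<Psi> (h (1, \<Theta> y)) = y"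
      using h(3) comm sX retr by (auto simp: V_def)
    ultimately show ?thesis
      using V Vinv unfolding G_sectional_def G_map_def
      by (intro conjI exI[of _ "\<lambda>y. \<Phi> (s (\<Theta> y))"] exI[of _ "\<lambda>(t, y). \<Psi> (h (t, \<Theta> y))"]) auto
  qed
  moreover have "(\<Union>i<k. V i) = topspace Y'"
    using \<Theta>Y cover(3) by (auto simp: V_def)
  ultimately show ?thesis
    using secat_G_le[OF cover(2)] cover(1) by metis
qed

section \<open>Fibre products and path spaces of a product\<close>

lemma topspace_fibre_product:
  "topspace (fibre_product E p) = {(e, e'). e \<in> topspace E \<and> e' \<in> topspace E \<and> p e = p e'}"
  by (auto simp: fibre_product_def)

text \<open>
  The set of pairs that defines the fibre product also contains pairs outside \<open>E\<close>, where the
  action is arbitrary; cut down to the points of the space it is invariant.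
\<close>

lemma fibre_product_eq:
  "fibre_product E p = subtopology (prod_topology E E) (topspace (fibre_product E p))"
  unfolding fibre_product_def by (simp only: topspace_subtopology subtopology_restrict)

lemma topspace_fibrewise_path_space:
  "topspace (fibrewise_path_space E B p) =
    {\<gamma> \<in> mapping_set unit_interval E. \<exists>b\<in>topspace B. \<forall>t\<in>{0..1}. p (\<gamma> t) = b}"
  by (auto simp: fibrewise_path_space_def)

lemma group_action_fibre_product:
  assumes G: "group G" and E: "group_action G (topspace E) (\<lambda>g. restrict (\<phi> g) (topspace E))"
    and p: "equivariant G (topspace E) \<phi> \<psi> p"
  shows "group_action G (topspace (fibre_product E p))
    (\<lambda>g. restrict (diagonal_action \<phi> g) (topspace (fibre_product E p)))"
  using E p unfolding group_action_restrict_iff[OF G] equivariant_def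
  by (auto simp: topspace_fibre_product diagonal_action_def)

text \<open>
  A point of the fibre product of \<open>p \<times> p'\<close> is a pair of points of \<open>E \<times> E'\<close>,
  a point of the product of the fibre products is a pair of endpoint pairs.  Exchanging the middle
  coordinates passes from either description to the other, being its own inverse.
\<close>

definition interchange :: "('a \<times> 'b) \<times> ('c \<times> 'd) \<Rightarrow> ('a \<times> 'c) \<times> ('b \<times> 'd)" where
  "interchange = (\<lambda>((a, b), (c, d)). ((a, c), (b, d)))"

lemma interchange_apply [simp]: "interchange ((a, b), (c, d)) = ((a, c), (b, d))"
  by (simp add: interchange_def)

lemma continuous_map_interchange:
  "continuous_map (prod_topology (prod_topology A B) (prod_topology C D))
    (prod_topology (prod_topology A C) (prod_topology B D)) interchange"
  unfolding interchange_def case_prod_unfold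
  by (intro continuous_map_pairedI
      continuous_map_compose[OF continuous_map_fst continuous_map_fst, unfolded o_def]
      continuous_map_compose[OF continuous_map_fst continuous_map_snd, unfolded o_def]
      continuous_map_compose[OF continuous_map_snd continuous_map_fst, unfolded o_def]
      continuous_map_compose[OF continuous_map_snd continuous_map_snd, unfolded o_def])

lemma G_map_interchange_fibre_product:
  "G_map (G \<times>\<times> H) (prod_topology (fibre_product E p) (fibre_product E' p'))
     (product_action (diagonal_action \<phi>) (diagonal_action \<phi>'))
     (fibre_product (prod_topology E E') (map_prod p p'))
     (diagonal_action (product_action \<phi> \<phi>')) interchange"
  "G_map (G \<times>\<times> H) (fibre_product (prod_topology E E') (map_prod p p'))
     (diagonal_action (product_action \<phi> \<phi>'))
     (prod_topology (fibre_product E p) (fibre_product E' p'))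
     (product_action (diagonal_action \<phi>) (diagonal_action \<phi>')) interchange"
  unfolding G_map_def equivariant_def fibre_product_def subtopology_Times[symmetric]
  by (auto simp: continuous_map_in_subtopology continuous_map_from_subtopology
      continuous_map_interchange diagonal_action_def product_action_def)

text \<open>The restriction to the interval makes the value extensional, as points of path spaces are.\<close>

definition pair_path :: "(real \<Rightarrow> 'x) \<times> (real \<Rightarrow> 'y) \<Rightarrow> real \<Rightarrow> 'x \<times> 'y" where
  "pair_path = (\<lambda>(\<gamma>, \<delta>). \<lambda>t\<in>{0..1}. (\<gamma> t, \<delta> t))"

text \<open>
  Evaluation of paths is jointly continuous because the interval is locally compact Hausdorff; so
  the adjoint map on \<open>I \<times> (X\<^sup>I \<times> Y\<^sup>I)\<close> is continuous, and currying returns to the path space.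
\<close>

lemma continuous_map_pair_path:
  "continuous_map (prod_topology (path_space_topology X) (path_space_topology Y))
    (path_space_topology (prod_topology X Y)) pair_path"
proof -
  let ?P = "prod_topology (path_space_topology X) (path_space_topology Y)"
  let ?Z = "prod_topology unit_interval ?P"
  note ev = continuous_map_evaluation[OF locally_compact_unit_interval Hausdorff_unit_interval]
  have 1: "continuous_map ?Z (path_space_topology X) (\<lambda>z. fst (snd z))"
      "continuous_map ?Z (path_space_topology Y) (\<lambda>z. snd (snd z))"
    using continuous_map_compose[OF continuous_map_snd continuous_map_fst]
      continuous_map_compose[OF continuous_map_snd continuous_map_snd] by (auto simp: o_def)
  have "continuous_map ?Z X (\<lambda>z. fst (snd z) (fst z))"
    using continuous_map_compose[OF continuous_map_pairedI[OF continuous_map_fst 1(1)] ev]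
    by (simp add: o_def)
  moreover have "continuous_map ?Z Y (\<lambda>z. snd (snd z) (fst z))"
    using continuous_map_compose[OF continuous_map_pairedI[OF continuous_map_fst 1(2)] ev]
    by (simp add: o_def)
  ultimately have "continuous_map ?Z (prod_topology X Y)
      (\<lambda>z. (fst (snd z) (fst z), snd (snd z) (fst z)))"
    by (rule continuous_map_pairedI)
  from continuous_map_curry[OF this] show ?thesis
    by (simp add: pair_path_def case_prod_unfold)
qed

lemma G_map_pair_path:
  "G_map (G \<times>\<times> H) (prod_topology (fibrewise_path_space E B p) (fibrewise_path_space E' B' p'))
     (product_action (path_action \<phi>) (path_action \<phi>'))
     (fibrewise_path_space (prod_topology E E') (prod_topology B B') (map_prod p p'))
     (path_action (product_action \<phi> \<phi>')) pair_path"
proof -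
  let ?X = "prod_topology (fibrewise_path_space E B p) (fibrewise_path_space E' B' p')"
  have "continuous_map ?X (path_space_topology (prod_topology E E')) pair_path"
    unfolding fibrewise_path_space_def subtopology_Times[symmetric]
    by (rule continuous_map_from_subtopology[OF continuous_map_pair_path])
  moreover have "\<exists>b\<in>topspace (prod_topology B B'). \<forall>t\<in>{0..1}. map_prod p p' (pair_path z t) = b"
    if "z \<in> topspace ?X" for z
    using that by (fastforce simp: topspace_fibrewise_path_space pair_path_def)
  ultimately have "continuous_map ?X
      (fibrewise_path_space (prod_topology E E') (prod_topology B B') (map_prod p p')) pair_path"
    unfolding fibrewise_path_space_def[of "prod_topology E E'"]
    by (intro continuous_map_into_subtopology) auto
  then show ?thesis
    by (auto simp: G_map_def equivariant_def product_action_def path_action_def pair_path_def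
        fun_eq_iff)
qed

section \<open>Parametrized topological complexity of a product\<close>

theorem theorem3p8:
  fixes G\<^sub>1 :: "('g1, 'm1) monoid_scheme" and T\<^sub>1 :: "'g1 topology"
    and G\<^sub>2 :: "('g2, 'm2) monoid_scheme" and T\<^sub>2 :: "'g2 topology"
    and E\<^sub>1 :: "'e1 topology" and B\<^sub>1 :: "'b1 topology"
    and E\<^sub>2 :: "'e2 topology" and B\<^sub>2 :: "'b2 topology"
    and \<phi>\<^sub>1 :: "'g1 \<Rightarrow> 'e1 \<Rightarrow> 'e1" and \<psi>\<^sub>1 :: "'g1 \<Rightarrow> 'b1 \<Rightarrow> 'b1"
    and \<phi>\<^sub>2 :: "'g2 \<Rightarrow> 'e2 \<Rightarrow> 'e2" and \<psi>\<^sub>2 :: "'g2 \<Rightarrow> 'b2 \<Rightarrow> 'b2"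
    and p\<^sub>1 :: "'e1 \<Rightarrow> 'b1" and p\<^sub>2 :: "'e2 \<Rightarrow> 'b2"
  assumes "topological_group G\<^sub>1 T\<^sub>1" and "topological_group G\<^sub>2 T\<^sub>2"
    and "G_fibration G\<^sub>1 T\<^sub>1 E\<^sub>1 \<phi>\<^sub>1 B\<^sub>1 \<psi>\<^sub>1 p\<^sub>1"
    and "G_fibration G\<^sub>2 T\<^sub>2 E\<^sub>2 \<phi>\<^sub>2 B\<^sub>2 \<psi>\<^sub>2 p\<^sub>2"
    and "G_completely_normal (G\<^sub>1 \<times>\<times> G\<^sub>2)
           (prod_topology (prod_topology E\<^sub>1 E\<^sub>1) (prod_topology E\<^sub>2 E\<^sub>2))
           (product_action (diagonal_action \<phi>\<^sub>1) (diagonal_action \<phi>\<^sub>2))"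
  shows "TC_G (G\<^sub>1 \<times>\<times> G\<^sub>2) (prod_topology E\<^sub>1 E\<^sub>2) (product_action \<phi>\<^sub>1 \<phi>\<^sub>2)
           (prod_topology B\<^sub>1 B\<^sub>2) (map_prod p\<^sub>1 p\<^sub>2)
         \<le> TC_G G\<^sub>1 E\<^sub>1 \<phi>\<^sub>1 B\<^sub>1 p\<^sub>1 + TC_G G\<^sub>2 E\<^sub>2 \<phi>\<^sub>2 B\<^sub>2 p\<^sub>2 - 1"
proof -
  let ?G = "G\<^sub>1 \<times>\<times> G\<^sub>2"
  let ?Y\<^sub>1 = "fibre_product E\<^sub>1 p\<^sub>1" and ?Y\<^sub>2 = "fibre_product E\<^sub>2 p\<^sub>2"
  let ?Y = "fibre_product (prod_topology E\<^sub>1 E\<^sub>2) (map_prod p\<^sub>1 p\<^sub>2)"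
  let ?\<delta> = "product_action (diagonal_action \<phi>\<^sub>1) (diagonal_action \<phi>\<^sub>2)"
  have act\<^sub>1: "group_action G\<^sub>1 (topspace ?Y\<^sub>1) (\<lambda>g. restrict (diagonal_action \<phi>\<^sub>1 g) (topspace ?Y\<^sub>1))"
    using assms(1,3) unfolding topological_group_def G_fibration_def G_space_def G_map_def
    by (blast intro: group_action_fibre_product)
  have act\<^sub>2: "group_action G\<^sub>2 (topspace ?Y\<^sub>2) (\<lambda>g. restrict (diagonal_action \<phi>\<^sub>2 g) (topspace ?Y\<^sub>2))"
    using assms(2,4) unfolding topological_group_def G_fibration_def G_space_def G_map_def
    by (blast intro: group_action_fibre_product)
  have inv: "G_invariant G\<^sub>1 (diagonal_action \<phi>\<^sub>1) (topspace ?Y\<^sub>1)"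
      "G_invariant G\<^sub>2 (diagonal_action \<phi>\<^sub>2) (topspace ?Y\<^sub>2)"
    using assms(1,2) act\<^sub>1 act\<^sub>2 unfolding topological_group_def G_invariant_def
    by (auto simp: group_action_restrict_iff)
  have cn: "G_completely_normal ?G (prod_topology ?Y\<^sub>1 ?Y\<^sub>2) ?\<delta>"
    using G_completely_normal_subtopology[OF assms(5) G_invariant_Times[OF inv]]
    unfolding subtopology_Times fibre_product_eq[symmetric] .
  have invY: "G_invariant ?G (diagonal_action (product_action \<phi>\<^sub>1 \<phi>\<^sub>2)) (topspace ?Y)"
    using inv unfolding G_invariant_def topspace_fibre_product
    by (fastforce simp: diagonal_action_def product_action_def image_subset_iff)
  have "TC_G ?G (prod_topology E\<^sub>1 E\<^sub>2) (product_action \<phi>\<^sub>1 \<phi>\<^sub>2)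
      (prod_topology B\<^sub>1 B\<^sub>2) (map_prod p\<^sub>1 p\<^sub>2)
    \<le> secat_G ?G (prod_topology (fibrewise_path_space E\<^sub>1 B\<^sub>1 p\<^sub>1) (fibrewise_path_space E\<^sub>2 B\<^sub>2 p\<^sub>2))
        (product_action (path_action \<phi>\<^sub>1) (path_action \<phi>\<^sub>2)) (prod_topology ?Y\<^sub>1 ?Y\<^sub>2) ?\<delta>
        (map_prod endpoint_map endpoint_map)"
    unfolding TC_G_def
    by (rule secat_G_le_retract[OF G_map_pair_path G_map_interchange_fibre_product invY])
      (auto simp: interchange_def endpoint_map_def pair_path_def)
  also have "\<dots> \<le> TC_G G\<^sub>1 E\<^sub>1 \<phi>\<^sub>1 B\<^sub>1 p\<^sub>1 + TC_G G\<^sub>2 E\<^sub>2 \<phi>\<^sub>2 B\<^sub>2 p\<^sub>2 - 1"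
    unfolding TC_G_def by (rule secat_G_prod_le[OF act\<^sub>1 act\<^sub>2 cn])
  finally show ?thesis .
qed

end
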